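(* Let $T$ be an irreducible $n\times n$ matrix with entries in $\{0,1\}$ whose largest eigenvalue $\lambda$ satisfies $\lambda>1$, and let $\Sigma$ be the associated subshift of finite type. There exists a constant $C$ depending only on $\Sigma$ such that the following holds. Let $S$ be any finite set of finite admissible nonempty words, none of which contains another, and put $p(x)=\sum_{\tau\in S}x^{|\tau|}$. If $k$ is a positive integer, every element of $S$ has length at least $k$, and there exists $t\in(1,\lambda^k)$ with $$r=\frac{1+kC\lambda^{2k}\,p(t^{1/k}/\lambda)}{t}<1,$$ then $$h(\Sigma)-h(\Sigma\langle S\rangle)\le -\frac{\log(1-r)}{k}.$$
   Context: The subshift $\Sigma$ is the set of all bi-infinite strings $(x_i)_{i\in\mathbb{Z}}$ on the alphabet $\{1,\dots,n\}$ (indexing the rows and columns of $T$) such that the $(x_{i+1},x_i)$ entry of $T$ equals $1$ for all $i\in\mathbb{Z}$, with the shift map. A finite word is admissible if all its consecutive pairs of symbols satisfy this same condition; $|\tau|$ denotes the length of a word $\tau$. A word contains another if the latter occurs in it as a block of consecutive symbols. $\Sigma\langle S\rangle$ is the subshift of $\Sigma$ consisting of those elements of $\Sigma$ in which none of the words of $S$ appears. For a subshift $X$, $h(X)$ denotes the topological entropy of the shift map on $X$, i.e. $h(X)=\lim_{m\to\infty}\frac1m\log\#\{\text{words of length } m \text{ occurring in elements of } X\}$ (natural logarithm, $\log 0=-\infty$). One has $\lambda=e^{h(\Sigma)}$. *)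

theory Defs
  imports
    "HOL-Analysis.Analysis"
    "HOL-Library.Sublist"
    "Jordan_Normal_Form.Char_Poly"
begin

text \<open>The symbols are the row and column indices of the matrix. Matrices of
  \<open>Jordan_Normal_Form\<close> are indexed from 0, so the alphabet of an
  \<open>n \<times> n\<close> matrix is \<open>{0..<n}\<close>.\<close>

definition zero_one_mat :: "nat \<Rightarrow> real mat \<Rightarrow> bool" where
  "zero_one_mat n T \<longleftrightarrow> T \<in> carrier_mat n n \<and> (\<forall>i<n. \<forall>j<n. T $$ (i, j) \<in> {0, 1})"

definition irreducible_mat :: "nat \<Rightarrow> real mat \<Rightarrow> bool" where
  "irreducible_mat n T \<longleftrightarrow> (\<forall>i<n. \<forall>j<n. \<exists>m>0. (T ^\<^sub>m m) $$ (i, j) > 0)"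

text \<open>The largest among the real eigenvalues; for a nonnegative matrix this is the
  Perron--Frobenius eigenvalue.\<close>

definition largest_eigenvalue :: "real mat \<Rightarrow> real \<Rightarrow> bool" where
  "largest_eigenvalue T l \<longleftrightarrow> eigenvalue T l \<and> (\<forall>m. eigenvalue T m \<longrightarrow> m \<le> l)"

text \<open>A transition from \<open>a\<close> to \<open>b\<close> is governed by the \<open>(b, a)\<close> entry.\<close>

definition SFT :: "nat \<Rightarrow> real mat \<Rightarrow> (int \<Rightarrow> nat) set" where
  "SFT n T = {x. (\<forall>i. x i < n) \<and> (\<forall>i. T $$ (x (i + 1), x i) = 1)}"

definition admissible :: "nat \<Rightarrow> real mat \<Rightarrow> nat list \<Rightarrow> bool" where
  "admissible n T w \<longleftrightarrow>
     (\<forall>i<length w. w ! i < n) \<and> (\<forall>i. Suc i < length w \<longrightarrow> T $$ (w ! Suc i, w ! i) = 1)"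

definition appears_in :: "'a list \<Rightarrow> (int \<Rightarrow> 'a) \<Rightarrow> bool" where
  "appears_in w x \<longleftrightarrow> (\<exists>i. \<forall>j<length w. x (i + int j) = w ! j)"

definition avoiding :: "(int \<Rightarrow> 'a) set \<Rightarrow> 'a list set \<Rightarrow> (int \<Rightarrow> 'a) set" where
  "avoiding X S = {x \<in> X. \<forall>\<tau>\<in>S. \<not> appears_in \<tau> x}"

definition words_of_length :: "(int \<Rightarrow> 'a) set \<Rightarrow> nat \<Rightarrow> 'a list set" where
  "words_of_length X m = {w. length w = m \<and> (\<exists>x\<in>X. appears_in w x)}"

text \<open>Extended real valued, so that \<open>log 0 = -\<infinity>\<close>: the empty subshift has entropy \<open>-\<infinity>\<close>.\<close>

definition log_count :: "'a set \<Rightarrow> ereal" where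
  "log_count A = (if card A = 0 then -\<infinity> else ereal (ln (real (card A))))"

definition entropy :: "(int \<Rightarrow> 'a) set \<Rightarrow> ereal" where
  "entropy X = lim (\<lambda>m. log_count (words_of_length X m) / ereal (real m))"

definition length_poly :: "'a list set \<Rightarrow> real \<Rightarrow> real" where
  "length_poly S x = (\<Sum>\<tau>\<in>S. x ^ length \<tau>)"

end

theory Submission
  imports Defs
begin

text \<open>
Let \<open>v\<close> be the Perron eigenvector of \<open>T\<close>. Since entry \<open>(b, a)\<close> of \<open>T\<close> governs the transition from
  \<open>a\<close> to \<open>b\<close>, the equation \<open>T v = \<lambda> v\<close> says that the weights \<open>v a\<close> of the symbols which may be put
  to the left of a word starting with \<open>b\<close> add up to \<open>\<lambda> v b\<close>. Give every word the weight of its first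
  symbol, and let \<open>A m\<close> be the total weight of the admissible words of length \<open>m\<close> which avoid \<open>S\<close>.
  Extending all of these by one symbol on the left multiplies the total weight by exactly \<open>\<lambda>\<close>. An
  extension that fails to avoid \<open>S\<close> must begin with some \<open>\<tau> \<in> S\<close>, the rest being an avoiding word of
  length \<open>m + 1 - |\<tau>|\<close>. With \<open>C\<close> the largest weight of a
  symbol divided by the least weight of a word, this gives
  \<open>\<lambda> A(m) - C (\<Sum>\<tau>\<in>S. A(m + 1 - |\<tau>|)) \<le> A(m + 1) \<le> \<lambda> A(m)\<close>
  (lemmas \<open>total_loss\<close> and \<open>total_growth\<close>).

  The rest of the argument for \<open>A\<close> is an induction in steps of size \<open>k\<close>, in the spirit of the
  Golod--Shafarevich inequality (locale \<open>forbidden_recursion\<close>). Put \<open>s = t powr (1 / k)\<close>. As long as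
  \<open>A\<close> has grown at least by the factor \<open>(\<lambda> / s)^k = \<lambda>^k / t\<close> in each earlier step, the earlier values
  of \<open>A\<close> that occur in the loss terms of the next \<open>k\<close> extensions are so small compared with the present
  one that the loss during the step is at most the proportion \<open>r - 1 / t\<close> of \<open>\<lambda>^k A(N k)\<close>. What remains
  is growth at least by the factor \<open>\<lambda>^k (1 - r + 1 / t)\<close>. Because \<open>r < 1\<close>, it exceeds \<open>\<lambda>^k / t\<close>, which keeps the induction
  going, and it exceeds \<open>\<lambda>^k (1 - r)\<close>, which is the growth rate wanted.

  Growth of the number of avoiding words is not yet growth of the number of words occurring in
  \<open>\<Sigma>\<langle>S\<rangle>\<close>, since an avoiding word may fail to extend to a bi-infinite one. By compactness,
  for each \<open>m\<close> there is an \<open>M\<close> such that the words of length \<open>m\<close> with avoiding extensions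
  by at least \<open>M\<close> symbols on both sides all occur in the subshift. Cutting a long avoiding word, apart from
  its two ends of length \<open>M\<close>, into blocks of length \<open>m\<close> then bounds the number of avoiding words by
  powers of the number of occurring words of length \<open>m\<close> (lemma \<open>words_growth\<close>). Hence the entropy of the
  avoiding subshift is at least \<open>ln (\<lambda>^k (1 - r)) / k\<close>. The upper bound \<open>A m \<le> \<lambda>^m A 0\<close> for
  \<open>S = {}\<close> shows that the entropy of the whole subshift is at most \<open>ln \<lambda>\<close>, and subtraction gives the theorem.
\<close>

section \<open>Subadditive sequences\<close>

lemma subadditive_mult:
  fixes a :: "nat \<Rightarrow> real"
  assumes sub: "\<And>m m'. a (m + m') \<le> a m + a m'"
  shows "a (q * m + r) \<le> real q * a m + a r"
proof (induction q)
  case (Suc q)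
  have "a (Suc q * m + r) \<le> a m + a (q * m + r)"
    using sub[of m "q * m + r"] by (simp add: algebra_simps)
  with Suc show ?case by (simp add: algebra_simps)
qed simp

text \<open>Fekete's lemma: the limit is the infimum \<open>L\<close> of \<open>a m / m\<close>, because writing \<open>N = q * m + r\<close> bounds
  \<open>a N\<close> by \<open>q * a m\<close> up to an error that depends only on a nearly optimal \<open>m\<close>. It is what makes the limit in the
  definition of entropy exist.\<close>

lemma subadditive_convergent:
  fixes a :: "nat \<Rightarrow> real"
  assumes sub: "\<And>m m'. a (m + m') \<le> a m + a m'"
    and lower: "\<And>m. m > 0 \<Longrightarrow> c * real m \<le> a m"
  shows "convergent (\<lambda>m. a m / real m)"
proof -
  define L where "L = (INF m\<in>{0<..}. a m / real m)"
  have bdd: "bdd_below ((\<lambda>m. a m / real m) ` {0<..})"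
    by (rule bdd_belowI2[of _ c]) (use lower in \<open>auto simp: field_simps\<close>)
  have L_le: "L \<le> a m / real m" if "m > 0" for m
    unfolding L_def using that by (intro cINF_lower[OF bdd]) auto
  have "(\<lambda>m. a m / real m) \<longlonglongrightarrow> L"
  proof (rule LIMSEQ_I)
    fix e :: real assume e: "e > 0"
    obtain E where E: "E = L + e / 2" by blast
    have "\<exists>m\<in>{0<..}. a m / real m < E"
      using e bdd by (subst cINF_less_iff[symmetric]) (auto simp: L_def E)
    then obtain m where m: "m > 0" "a m / real m < E" by auto
    define B where "B = Max ((\<lambda>r. \<bar>a r\<bar>) ` {..<m}) + \<bar>E\<bar> * real m"
    have aB: "\<bar>a r\<bar> + \<bar>E\<bar> * real m \<le> B" if "r < m" for r
      unfolding B_def using that by (auto intro!: Max_ge)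
    have B0: "B \<ge> 0" using aB[of 0] m by (smt (verit) abs_ge_zero mult_nonneg_nonneg of_nat_0_le_iff)
    obtain N0 :: nat where N0: "real N0 > 2 * B / e" using reals_Archimedean2 by blast
    show "\<exists>N0. \<forall>N\<ge>N0. norm (a N / real N - L) < e"
    proof (intro exI allI impI)
      fix N assume N: "N \<ge> Suc N0"
      hence Np: "real N > 0" by simp
      define q r where "q = N div m" and "r = N mod m"
      have r: "r < m" and Nqr: "N = q * m + r" using m by (auto simp: q_def r_def)
      have "a N \<le> real q * a m + a r" unfolding Nqr by (rule subadditive_mult[OF sub])
      also have "real q * a m \<le> real q * (real m * E)"
        using m by (intro mult_left_mono) (auto simp: field_simps)
      also have "real q * (real m * E) = (real N - real r) * E"
        unfolding Nqr by (simp add: algebra_simps)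
      also have "\<dots> + a r \<le> real N * E + B"
      proof -
        have "- (real r * E) \<le> real m * \<bar>E\<bar>"
        proof -
          have "- (real r * E) \<le> \<bar>real r * E\<bar>" by (rule abs_ge_minus_self)
          also have "\<dots> = real r * \<bar>E\<bar>" by (simp add: abs_mult)
          also have "\<dots> \<le> real m * \<bar>E\<bar>" using r by (intro mult_right_mono) auto
          finally show ?thesis .
        qed
        thus ?thesis using aB[OF r] by (simp add: algebra_simps)
      qed
      finally have "a N \<le> real N * (L + e / 2) + B" by (simp add: E)
      moreover have "B < real N * (e / 2)"
        using N0 N e Np by (auto simp: field_simps)
           (smt (verit) mult_left_mono of_nat_mono Suc_leD)
      ultimately have "a N < real N * (L + e)" by (simp add: algebra_simps)
      hence "a N / real N < L + e" using Np by (simp add: field_simps)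
      moreover have "L \<le> a N / real N" using L_le N by simp
      ultimately show "norm (a N / real N - L) < e" by (simp add: abs_if)
    qed
  qed
  thus ?thesis by (auto simp: convergent_def)
qed

lemma base_le_of_power_bound:
  fixes x y :: real
  assumes "c > 0" "x > 0" "y \<ge> 0" and bound: "\<And>q. c * x ^ q \<le> D * y ^ q"
  shows "x \<le> y"
proof (rule ccontr)
  assume "\<not> x \<le> y"
  hence "(\<lambda>q. D * (y / x) ^ q) \<longlonglongrightarrow> D * 0"
    using assms by (intro tendsto_mult_left LIMSEQ_realpow_zero) auto
  moreover have "\<forall>q. c \<le> D * (y / x) ^ q"
    using bound assms by (auto simp: power_divide field_simps)
  ultimately have "c \<le> D * 0" by (intro LIMSEQ_le_const) auto
  thus False using assms by simp
qed

section \<open>Growth forced by a recursive inequality\<close>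

text \<open>The analytic core, freed from words. Here \<open>A m\<close> stands for the total weight of the avoiding words of length \<open>m\<close>, and the sum in
  \<open>loss\<close> for the weight of the extensions that begin with a forbidden word. The parameter \<open>s\<close> is
  the \<open>k\<close>-th root of the \<open>t\<close> of the theorem, and \<open>small\<close> is the hypothesis \<open>r < 1\<close> cleared of its
  denominator.\<close>

locale forbidden_recursion =
  fixes A :: "nat \<Rightarrow> real" and S :: "'a set" and len :: "'a \<Rightarrow> nat"
    and lam C s :: real and k :: nat
  assumes nonneg: "\<And>m. A m \<ge> 0"
    and growth: "\<And>m. A (Suc m) \<le> lam * A m"
    and loss: "\<And>m. A (Suc m) \<ge> lam * A m
      - C * (\<Sum>\<tau>\<in>S. if len \<tau> \<le> Suc m then A (Suc m - len \<tau>) else 0)"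
    and k: "k > 0" and len: "\<And>\<tau>. \<tau> \<in> S \<Longrightarrow> k \<le> len \<tau>"
    and C: "C \<ge> 0" and s: "1 < s" "s ^ k < lam ^ k" and lam: "lam > 0"
    and small: "1 + real k * C * lam ^ (2 * k) * (\<Sum>\<tau>\<in>S. (s / lam) ^ len \<tau>) < s ^ k"
begin

abbreviation weight_sum :: real where
  "weight_sum \<equiv> \<Sum>\<tau>\<in>S. (s / lam) ^ len \<tau>"

lemma weight_sum_nonneg: "weight_sum \<ge> 0"
  using s lam by (intro sum_nonneg) auto

lemma growth_power: "A (m + b) \<le> lam ^ b * A m"
proof (induction b)
  case (Suc b)
  have "A (m + Suc b) \<le> lam * A (m + b)" using growth by simp
  also have "\<dots> \<le> lam * (lam ^ b * A m)" using Suc lam by (intro mult_left_mono) auto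
  finally show ?case by (simp add: algebra_simps)
qed simp

text \<open>In steps of \<open>k\<close>, going back from \<open>N * k\<close> costs a factor \<open>s / lam\<close> per index. An index \<open>i\<close> that is
  not a multiple of \<open>k\<close> is compared with the multiple \<open>i - b\<close> just below it. The growth bound pays
  \<open>lam ^ b\<close> there where \<open>(lam / s) ^ b\<close> would be needed, hence the extra factor \<open>s ^ k\<close>.\<close>

lemma earlier_term_bound:
  assumes blocks: "\<And>N'. N' < N \<Longrightarrow> A (N' * k) \<le> (s / lam) ^ k * A (Suc N' * k)"
    and i: "i \<le> N * k"
  shows "A i \<le> s ^ k * (s / lam) ^ (N * k - i) * A (N * k)"
proof -
  have backwards: "A ((N - d) * k) \<le> (s / lam) ^ (d * k) * A (N * k)" if "d \<le> N" for d
    using that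
  proof (induction d)
    case (Suc d)
    hence eq: "Suc (N - Suc d) = N - d" by simp
    have "A ((N - Suc d) * k) \<le> (s / lam) ^ k * A ((N - d) * k)"
      using blocks[of "N - Suc d"] Suc.prems unfolding eq by simp
    also have "\<dots> \<le> (s / lam) ^ k * ((s / lam) ^ (d * k) * A (N * k))"
      using Suc s lam by (intro mult_left_mono) auto
    finally show ?case by (simp add: power_add algebra_simps)
  qed simp
  define a b where "a = i div k" and "b = i mod k"
  have iab: "i = a * k + b" and bk: "b < k" using k by (auto simp: a_def b_def)
  have aN: "a \<le> N" using i k unfolding a_def by (metis div_le_mono div_mult_self_is_m mult.commute)
  have exps: "(N - a) * k = (N * k - i) + b"
    using i aN unfolding iab by (simp add: diff_mult_distrib)
  have "A i \<le> lam ^ b * A (a * k)" unfolding iab by (rule growth_power)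
  also have "A (a * k) \<le> (s / lam) ^ ((N - a) * k) * A (N * k)"
    using backwards[of "N - a"] aN by simp
  also have "lam ^ b * \<dots> = s ^ b * ((s / lam) ^ (N * k - i) * A (N * k))"
    unfolding exps using lam by (simp add: power_add power_divide)
  also have "\<dots> \<le> s ^ k * ((s / lam) ^ (N * k - i) * A (N * k))"
    using s bk lam nonneg by (intro mult_right_mono power_increasing) auto
  finally show ?thesis using lam by (simp add: mult_ac)
qed

text \<open>The step from \<open>j\<close> to \<open>j + 1\<close> loses at most the proportion \<open>C * s ^ k * weight_sum\<close> of \<open>lam ^ (j + 1) * A (N * k)\<close>.
  Here \<open>k \<le> len \<tau>\<close> and \<open>j < k\<close> guarantee that every loss term refers to an index at most \<open>N * k\<close>,
  where \<open>earlier_term_bound\<close> applies.\<close>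

lemma block_loss:
  assumes blocks: "\<And>N'. N' < N \<Longrightarrow> A (N' * k) \<le> (s / lam) ^ k * A (Suc N' * k)"
    and "j \<le> k"
  shows "A (N * k + j) \<ge> lam ^ j * A (N * k) * (1 - C * real j * s ^ k * weight_sum)"
  using \<open>j \<le> k\<close>
proof (induction j)
  case (Suc j)
  let ?m = "N * k"
  have term_bound: "(if len \<tau> \<le> Suc (?m + j) then A (Suc (?m + j) - len \<tau>) else 0)
      \<le> s ^ k * lam ^ Suc j * A ?m * (s / lam) ^ len \<tau>" if "\<tau> \<in> S" for \<tau>
  proof (cases "len \<tau> \<le> Suc (?m + j)")
    case True
    have kl: "k \<le> len \<tau>" by (rule len[OF that])
    define i where "i = Suc (?m + j) - len \<tau>"
    have i: "i \<le> ?m" and e: "len \<tau> = (?m - i) + Suc j"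
      using True kl Suc.prems by (auto simp: i_def)
    have "A i \<le> s ^ k * (s / lam) ^ (?m - i) * A ?m"
      by (rule earlier_term_bound[OF blocks i])
    \<comment> \<open>Completes the exponent of \<open>s\<close> to \<open>len \<tau>\<close>, so that the bound becomes a term of \<open>weight_sum\<close>.\<close>
    also have "\<dots> \<le> s ^ k * (s / lam) ^ (?m - i) * A ?m * s ^ Suc j"
    proof -
      have "1 \<le> s ^ Suc j" using s by (intro one_le_power) auto
      moreover have "0 \<le> s ^ k * (s / lam) ^ (?m - i) * A ?m"
        using s lam nonneg[of ?m] by simp
      ultimately show ?thesis by (metis mult.right_neutral mult_left_mono)
    qed
    also have "\<dots> = s ^ k * lam ^ Suc j * A ?m * (s / lam) ^ len \<tau>"
      unfolding e using lam by (simp add: power_add power_divide field_simps)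
    finally show ?thesis using True by (simp add: i_def)
  qed (use s lam nonneg in auto)
  have "(\<Sum>\<tau>\<in>S. if len \<tau> \<le> Suc (?m + j) then A (Suc (?m + j) - len \<tau>) else 0)
      \<le> s ^ k * lam ^ Suc j * A ?m * weight_sum"
    using sum_mono[OF term_bound] by (simp add: sum_distrib_left)
  hence "A (?m + Suc j) \<ge> lam * A (?m + j) - C * (s ^ k * lam ^ Suc j * A ?m * weight_sum)"
    using loss[of "?m + j"] C mult_left_mono by fastforce
  moreover have "lam * A (?m + j) \<ge> lam * (lam ^ j * A ?m * (1 - C * real j * s ^ k * weight_sum))"
    using Suc lam by (intro mult_left_mono) auto
  ultimately have "A (?m + Suc j) \<ge> lam * (lam ^ j * A ?m * (1 - C * real j * s ^ k * weight_sum))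
      - C * (s ^ k * lam ^ Suc j * A ?m * weight_sum)"
    by linarith
  thus ?case by (simp add: algebra_simps)
qed simp

text \<open>The number \<open>r\<close> of the theorem.\<close>

definition loss_ratio :: real where
  "loss_ratio = (1 + real k * C * lam ^ (2 * k) * weight_sum) / s ^ k"

lemma loss_ratio_less_1: "loss_ratio < 1"
  using small s by (simp add: loss_ratio_def)

text \<open>Since \<open>s ^ k < lam ^ k\<close>, the factor \<open>s ^ k\<close> in \<open>block_loss\<close> is at most \<open>lam ^ (2 * k) / s ^ k\<close>, which
  turns the loss into \<open>loss_ratio - 1 / s ^ k\<close>.\<close>

lemma block_growth_aux:
  assumes blocks: "\<And>N'. N' < N \<Longrightarrow> A (N' * k) \<le> (s / lam) ^ k * A (Suc N' * k)"
  shows "A (Suc N * k) \<ge> lam ^ k * (1 - loss_ratio + 1 / s ^ k) * A (N * k)"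
proof -
  have sk: "s ^ k > 0" using s by simp
  have "s ^ k * s ^ k \<le> lam ^ k * lam ^ k" using s lam by (intro mult_mono) auto
  hence "s ^ k \<le> lam ^ (2 * k) / s ^ k"
    using sk by (simp add: field_simps power_mult power2_eq_square power_mult_distrib)
  hence "C * real k * s ^ k * weight_sum \<le> C * real k * (lam ^ (2 * k) / s ^ k) * weight_sum"
    using C weight_sum_nonneg by (intro mult_right_mono mult_left_mono) auto
  also have "\<dots> = loss_ratio - 1 / s ^ k"
    using sk by (simp add: loss_ratio_def add_divide_distrib mult_ac)
  finally have "1 - C * real k * s ^ k * weight_sum \<ge> 1 - loss_ratio + 1 / s ^ k" by simp
  hence "lam ^ k * A (N * k) * (1 - C * real k * s ^ k * weight_sum)
      \<ge> lam ^ k * A (N * k) * (1 - loss_ratio + 1 / s ^ k)"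
    using lam nonneg by (intro mult_left_mono) auto
  also have "A (Suc N * k) \<ge> lam ^ k * A (N * k) * (1 - C * real k * s ^ k * weight_sum)"
    using block_loss[of N k] blocks by (simp add: add.commute)
  finally show ?thesis by (simp add: mult_ac)
qed

text \<open>The growth factor of \<open>block_growth_aux\<close> is at least \<open>lam ^ k / s ^ k\<close> because \<open>loss_ratio < 1\<close>; the
  hypothesis of the induction therefore reproduces itself.\<close>

lemma block_back: "A (N * k) \<le> (s / lam) ^ k * A (Suc N * k)"
proof (induction N rule: less_induct)
  case (less N)
  have "lam ^ k * (1 / s ^ k) * A (N * k) \<le> lam ^ k * (1 - loss_ratio + 1 / s ^ k) * A (N * k)"
    using loss_ratio_less_1 lam nonneg by (intro mult_right_mono mult_left_mono) auto
  also have "\<dots> \<le> A (Suc N * k)" by (rule block_growth_aux[OF less])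
  finally show ?case using s lam by (simp add: power_divide field_simps)
qed

lemma block_growth: "A (N * k) \<ge> (lam ^ k * (1 - loss_ratio)) ^ N * A 0"
proof (induction N)
  case (Suc N)
  have "(lam ^ k * (1 - loss_ratio)) ^ Suc N * A 0
      \<le> (lam ^ k * (1 - loss_ratio)) * A (N * k)"
    using Suc loss_ratio_less_1 lam by (simp add: mult.assoc mult_left_mono)
  also have "\<dots> \<le> lam ^ k * (1 - loss_ratio + 1 / s ^ k) * A (N * k)"
    using s lam nonneg by (intro mult_right_mono mult_left_mono) auto
  also have "\<dots> \<le> A (Suc N * k)" by (intro block_growth_aux block_back)
  finally show ?case .
qed simp

end

section \<open>The Perron eigenvector\<close>

lemma simultaneous_convergent_subsequence:
  fixes f :: "nat \<Rightarrow> nat \<Rightarrow> real"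
  assumes "\<And>m i. i < n \<Longrightarrow> f m i \<in> {0..1}"
  obtains r l where "strict_mono (r :: nat \<Rightarrow> nat)" "\<And>i. i < n \<Longrightarrow> (\<lambda>m. f (r m) i) \<longlonglongrightarrow> l i"
proof -
  have "\<exists>r l. strict_mono (r :: nat \<Rightarrow> nat) \<and> (\<forall>i<n. (\<lambda>m. f (r m) i) \<longlonglongrightarrow> l i)"
    using assms
  proof (induction n)
    case 0
    show ?case by (intro exI[of _ id]) (auto simp: strict_mono_def)
  next
    case (Suc n)
    then obtain r l where r: "strict_mono (r :: nat \<Rightarrow> nat)"
      and l: "\<And>i. i < n \<Longrightarrow> (\<lambda>m. f (r m) i) \<longlonglongrightarrow> l i" by force
    have "compact {0..1::real}" by simp
    moreover have "\<forall>m. f (r m) n \<in> {0..1}" using Suc.prems by simp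
    ultimately obtain q r' where r': "strict_mono (r' :: nat \<Rightarrow> nat)"
      and q: "((\<lambda>m. f (r m) n) \<circ> r') \<longlonglongrightarrow> q"
      unfolding compact_def by metis
    have "(\<lambda>m. f ((r \<circ> r') m) i) \<longlonglongrightarrow> (l(n := q)) i" if "i < Suc n" for i
    proof (cases "i = n")
      case True
      thus ?thesis using q by (simp add: o_def)
    next
      case False
      hence "((\<lambda>m. f (r m) i) \<circ> r') \<longlonglongrightarrow> l i"
        using that by (intro LIMSEQ_subseq_LIMSEQ[OF l r']) auto
      thus ?thesis using False by (simp add: o_def)
    qed
    thus ?case using strict_mono_o[OF r r'] by blast
  qed
  thus ?thesis using that by blast
qed

lemma pow_mat_nonneg:
  fixes T :: "real mat"
  assumes T: "T \<in> carrier_mat n n" and nonneg: "\<And>i j. i < n \<Longrightarrow> j < n \<Longrightarrow> T $$ (i, j) \<ge> 0"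
    and "i < n" "j < n"
  shows "(T ^\<^sub>m m) $$ (i, j) \<ge> 0"
  using assms(3,4)
proof (induction m arbitrary: i j)
  case 0
  thus ?case using T by simp
next
  case (Suc m)
  have "(T ^\<^sub>m Suc m) $$ (i, j) = (\<Sum>l<n. (T ^\<^sub>m m) $$ (i, l) * T $$ (l, j))"
    using Suc.prems T pow_carrier_mat[OF T, of m]
    by (simp add: scalar_prod_def atLeast0LessThan)
  also have "\<dots> \<ge> 0" using Suc nonneg by (intro sum_nonneg mult_nonneg_nonneg) auto
  finally show ?case .
qed

lemma pow_mat_commutes_entrywise:
  fixes T :: "real mat"
  assumes T: "T \<in> carrier_mat n n" and ij: "i < n" "j < n"
  shows "(\<Sum>l<n. T $$ (i, l) * (T ^\<^sub>m m) $$ (l, j)) = (\<Sum>l<n. (T ^\<^sub>m m) $$ (i, l) * T $$ (l, j))"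
proof -
  note P = pow_carrier_mat[OF T, of m]
  have "T * T ^\<^sub>m m = T ^\<^sub>m m * T"
  proof (induction m)
    case 0
    thus ?case using T by simp
  next
    case (Suc m)
    have "T * T ^\<^sub>m Suc m = (T * T ^\<^sub>m m) * T"
      using T pow_carrier_mat[OF T, of m] by (simp add: assoc_mult_mat[of _ n n _ n _ n])
    thus ?case using Suc by simp
  qed
  hence "(T * T ^\<^sub>m m) $$ (i, j) = (T ^\<^sub>m m * T) $$ (i, j)" by simp
  thus ?thesis using ij T P by (simp add: scalar_prod_def atLeast0LessThan)
qed

text \<open>A finite sum of powers of \<open>T\<close>, one for each pair of indices, chosen so that the power for \<open>(i, j)\<close> is
  positive at \<open>(i, j)\<close>. Such a matrix turns a nonnegative nonzero vector into a positive one, and commuting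
  with \<open>T\<close> it preserves equations and inequalities between \<open>T z\<close> and a multiple of \<open>z\<close>.\<close>

lemma irreducible_positive_commutant:
  fixes T :: "real mat"
  assumes T: "T \<in> carrier_mat n n" and nonneg: "\<And>i j. i < n \<Longrightarrow> j < n \<Longrightarrow> T $$ (i, j) \<ge> 0"
    and irr: "irreducible_mat n T"
  obtains K :: "nat \<Rightarrow> nat \<Rightarrow> real" where
    "\<And>i j. i < n \<Longrightarrow> j < n \<Longrightarrow> K i j > 0"
    "\<And>i j. i < n \<Longrightarrow> j < n \<Longrightarrow> (\<Sum>l<n. T $$ (i, l) * K l j) = (\<Sum>l<n. K i l * T $$ (l, j))"
proof -
  have "\<forall>i j. \<exists>m. i < n \<longrightarrow> j < n \<longrightarrow> (T ^\<^sub>m m) $$ (i, j) > 0"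
    using irr unfolding irreducible_mat_def by blast
  then obtain e where e: "\<And>i j. i < n \<Longrightarrow> j < n \<Longrightarrow> (T ^\<^sub>m e i j) $$ (i, j) > 0" by metis
  define K where "K i j = (\<Sum>x\<in>{..<n} \<times> {..<n}. (T ^\<^sub>m e (fst x) (snd x)) $$ (i, j))" for i j
  show ?thesis
  proof (rule that[of K])
    fix i j :: nat assume ij: "i < n" "j < n"
    show "K i j > 0" unfolding K_def
      using ij e[OF ij] pow_mat_nonneg[OF T nonneg ij]
      by (intro sum_pos2[of _ "(i, j)"]) auto
    have "(\<Sum>l<n. T $$ (i, l) * K l j)
        = (\<Sum>x\<in>{..<n} \<times> {..<n}. \<Sum>l<n. T $$ (i, l) * (T ^\<^sub>m e (fst x) (snd x)) $$ (l, j))"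
      unfolding K_def sum_distrib_left by (rule sum.swap)
    also have "\<dots> = (\<Sum>x\<in>{..<n} \<times> {..<n}. \<Sum>l<n. (T ^\<^sub>m e (fst x) (snd x)) $$ (i, l) * T $$ (l, j))"
      by (intro sum.cong refl pow_mat_commutes_entrywise[OF T ij])
    also have "\<dots> = (\<Sum>l<n. K i l * T $$ (l, j))"
      unfolding K_def sum_distrib_right by (rule sum.swap)
    finally show "(\<Sum>l<n. T $$ (i, l) * K l j) = (\<Sum>l<n. K i l * T $$ (l, j))" .
  qed
qed

lemma eigenvalue_iff_entrywise:
  fixes T :: "real mat"
  assumes T: "T \<in> carrier_mat n n"
  shows "eigenvalue T l \<longleftrightarrow>
    (\<exists>y. (\<exists>i<n. y i \<noteq> 0) \<and> (\<forall>i<n. (\<Sum>j<n. T $$ (i, j) * y j) = l * y i))"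
proof
  assume "eigenvalue T l"
  then obtain y where y: "y \<in> carrier_vec n" "y \<noteq> 0\<^sub>v n" "T *\<^sub>v y = l \<cdot>\<^sub>v y"
    using T unfolding eigenvalue_def eigenvector_def by auto
  have "(\<Sum>j<n. T $$ (i, j) * vec_index y j) = l * vec_index y i" if "i < n" for i
    using arg_cong[OF y(3), of "\<lambda>v. vec_index v i"] that y(1) T
    by (simp add: scalar_prod_def atLeast0LessThan)
  moreover have "\<exists>i<n. vec_index y i \<noteq> 0" using y(1,2) by (metis carrier_vecD eq_vecI index_zero_vec)
  ultimately show "\<exists>y. (\<exists>i<n. y i \<noteq> 0) \<and> (\<forall>i<n. (\<Sum>j<n. T $$ (i, j) * y j) = l * y i)"
    by blast
next
  assume "\<exists>y. (\<exists>i<n. y i \<noteq> 0) \<and> (\<forall>i<n. (\<Sum>j<n. T $$ (i, j) * y j) = l * y i)"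
  then obtain y i0 where y: "i0 < n" "y i0 \<noteq> 0"
    "\<And>i. i < n \<Longrightarrow> (\<Sum>j<n. T $$ (i, j) * y j) = l * y i" by blast
  have "T *\<^sub>v vec n y = l \<cdot>\<^sub>v vec n y"
    using T y(3) by (intro eq_vecI) (auto simp: scalar_prod_def atLeast0LessThan)
  moreover have "vec n y \<noteq> 0\<^sub>v n" using y(1,2) by (metis index_vec index_zero_vec(1))
  ultimately show "eigenvalue T l"
    using T unfolding eigenvalue_def eigenvector_def by (intro exI[of _ "vec n y"]) auto
qed

text \<open>The Collatz--Wielandt argument. Let \<open>rho\<close> be the supremum of the \<open>s\<close> for which some nonnegative
  \<open>z \<noteq> 0\<close> satisfies \<open>s z \<le> T z\<close>. It is attained by compactness of the simplex. A maximiser must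
  satisfy \<open>T z = rho z\<close>: otherwise applying the positive commutant makes the inequality strict in every
  coordinate, and \<open>rho\<close> could be increased. So \<open>rho\<close> is an eigenvalue, hence at most \<open>lam\<close>, while the
  absolute values of an eigenvector for \<open>lam\<close> show \<open>lam \<le> rho\<close>. The commutant applied to
  \<open>z\<close> is the positive eigenvector.\<close>

lemma perron_eigenvector:
  fixes T :: "real mat"
  assumes T: "T \<in> carrier_mat n n" and nonneg: "\<And>i j. i < n \<Longrightarrow> j < n \<Longrightarrow> T $$ (i, j) \<ge> 0"
    and irr: "irreducible_mat n T" and lam: "largest_eigenvalue T lam" "lam \<ge> 0"
  obtains v where "\<And>i. i < n \<Longrightarrow> v i > 0"
    "\<And>i. i < n \<Longrightarrow> (\<Sum>j<n. T $$ (i, j) * v j) = lam * v i" and "n > 0"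
proof -
  define actT where "actT z i = (\<Sum>j<n. T $$ (i, j) * z j)" for z i
  obtain K where K: "\<And>i j. i < n \<Longrightarrow> j < n \<Longrightarrow> K i j > (0::real)"
    "\<And>i j. i < n \<Longrightarrow> j < n \<Longrightarrow> (\<Sum>l<n. T $$ (i, l) * K l j) = (\<Sum>l<n. K i l * T $$ (l, j))"
    using irreducible_positive_commutant[OF T nonneg irr] by blast
  define actK where "actK z i = (\<Sum>j<n. K i j * z j)" for z i
  have comm: "actT (actK z) i = actK (actT z) i" if i: "i < n" for z i
  proof -
    have "actT (actK z) i = (\<Sum>l<n. \<Sum>j<n. T $$ (i, l) * K l j * z j)"
      unfolding actT_def actK_def by (simp add: sum_distrib_left mult.assoc)
    also have "\<dots> = (\<Sum>j<n. (\<Sum>l<n. T $$ (i, l) * K l j) * z j)"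
      unfolding sum_distrib_right by (rule sum.swap)
    also have "\<dots> = (\<Sum>j<n. (\<Sum>l<n. K i l * T $$ (l, j)) * z j)"
      using K(2) i by (intro sum.cong) auto
    also have "\<dots> = (\<Sum>l<n. \<Sum>j<n. K i l * T $$ (l, j) * z j)"
      unfolding sum_distrib_right by (rule sum.swap)
    also have "\<dots> = actK (actT z) i"
      unfolding actT_def actK_def by (simp add: sum_distrib_left mult.assoc)
    finally show ?thesis .
  qed
  have actK_pos: "actK z i > 0" if "i < n" "\<And>j. j < n \<Longrightarrow> z j \<ge> 0" "j0 < n" "z j0 > 0" for z i j0
    unfolding actK_def using that K(1)
    by (intro sum_pos2[of _ j0]) (auto intro!: mult_nonneg_nonneg simp: less_imp_le)
  define R where "R = {s. \<exists>z. (\<forall>i<n. 0 \<le> z i) \<and> (\<Sum>i<n. z i) = 1 \<and> (\<forall>i<n. s * z i \<le> actT z i)}"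
  have RI: "s \<in> R" if "\<And>i. i < n \<Longrightarrow> z i \<ge> 0" "i0 < n" "z i0 > 0"
      "\<And>i. i < n \<Longrightarrow> s * z i \<le> actT z i" for s z i0
  proof -
    define c where "c = (\<Sum>i<n. z i)"
    have c: "c > 0" unfolding c_def using that by (intro sum_pos2[of _ i0]) auto
    have "actT (\<lambda>i. z i / c) i = actT z i / c" for i
      unfolding actT_def by (simp add: sum_divide_distrib)
    moreover have "(\<Sum>i<n. z i / c) = 1"
      using c by (simp add: sum_divide_distrib[symmetric] c_def)
    ultimately show ?thesis unfolding R_def using c that
      by (intro CollectI exI[of _ "\<lambda>i. z i / c"]) (auto simp: divide_right_mono)
  qed
  obtain y i0 where y: "i0 < n" "y i0 \<noteq> 0" "\<And>i. i < n \<Longrightarrow> actT y i = lam * y i"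
    using lam(1) unfolding largest_eigenvalue_def eigenvalue_iff_entrywise[OF T] actT_def by blast
  have lamR: "lam \<in> R"
  proof (rule RI[of "\<lambda>i. \<bar>y i\<bar>" i0])
    fix i assume i: "i < n"
    have "lam * \<bar>y i\<bar> = \<bar>actT y i\<bar>" using y(3)[OF i] lam(2) by (simp add: abs_mult)
    also have "\<dots> \<le> actT (\<lambda>i. \<bar>y i\<bar>) i"
      unfolding actT_def by (rule sum_abs[THEN order_trans]) (use nonneg i in \<open>auto simp: abs_mult\<close>)
    finally show "lam * \<bar>y i\<bar> \<le> actT (\<lambda>i. \<bar>y i\<bar>) i" .
  qed (use y in auto)
  have bdd: "bdd_above R"
  proof (rule bdd_aboveI)
    fix s assume "s \<in> R"
    then obtain z where z: "\<And>i. i < n \<Longrightarrow> 0 \<le> z i" "(\<Sum>i<n. z i) = 1"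
      "\<And>i. i < n \<Longrightarrow> s * z i \<le> actT z i" unfolding R_def by blast
    have z1: "z j \<le> 1" if "j < n" for j
      using member_le_sum[of j "{..<n}" z] z(1,2) that by auto
    have "s = (\<Sum>i<n. s * z i)" using z(2) by (simp add: sum_distrib_left[symmetric])
    also have "\<dots> \<le> (\<Sum>i<n. actT z i)" using z(3) by (intro sum_mono) auto
    also have "\<dots> \<le> (\<Sum>i<n. \<Sum>j<n. T $$ (i, j))"
      unfolding actT_def using nonneg z1 z(1) by (intro sum_mono mult_right_le_one_le) auto
    finally show "s \<le> (\<Sum>i<n. \<Sum>j<n. T $$ (i, j))" .
  qed
  define rho where "rho = Sup R"
  have lam_rho: "lam \<le> rho" unfolding rho_def using lamR bdd by (rule cSup_upper)
  have "\<exists>s\<in>R. rho - 1 / real (Suc m) < s" for m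
    unfolding rho_def using lamR by (intro less_cSupD) auto
  then obtain s where s: "\<And>m. s m \<in> R" "\<And>m. rho - 1 / real (Suc m) < s m" by metis
  have "\<forall>m. \<exists>z. (\<forall>i<n. 0 \<le> z i) \<and> (\<Sum>i<n. z i) = 1 \<and> (\<forall>i<n. s m * z i \<le> actT z i)"
    using s(1) unfolding R_def by blast
  then obtain Z where Z: "\<And>m i. i < n \<Longrightarrow> 0 \<le> Z m i" "\<And>m. (\<Sum>i<n. Z m i) = 1"
    "\<And>m i. i < n \<Longrightarrow> s m * Z m i \<le> actT (Z m) i" by metis
  have Z01: "Z m i \<in> {0..1}" if "i < n" for m i
  proof -
    have "Z m i \<le> (\<Sum>j<n. Z m j)" using Z(1) that by (intro member_le_sum) auto
    thus ?thesis using Z(1)[OF that] Z(2) by simp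
  qed
  obtain r z where r: "strict_mono r" and lim: "\<And>i. i < n \<Longrightarrow> (\<lambda>m. Z (r m) i) \<longlonglongrightarrow> z i"
    by (rule simultaneous_convergent_subsequence[of n Z]) (use Z01 in auto)
  have z0: "z i \<ge> 0" if "i < n" for i
    using that Z(1) by (intro LIMSEQ_le_const[OF lim]) auto
  have "(\<lambda>m. \<Sum>i<n. Z (r m) i) \<longlonglongrightarrow> (\<Sum>i<n. z i)" by (intro tendsto_sum lim) auto
  hence zsum: "(\<Sum>i<n. z i) = 1" unfolding Z(2) by (simp add: LIMSEQ_const_iff)
  obtain j0 where j0: "j0 < n" "z j0 > 0"
  proof -
    have "\<exists>j0<n. z j0 \<noteq> 0"
    proof (rule ccontr)
      assume "\<not> ?thesis"
      hence "(\<Sum>i<n. z i) = 0" by (intro sum.neutral) auto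
      thus False using zsum by simp
    qed
    thus ?thesis using that z0 by force
  qed
  have zrho: "rho * z i \<le> actT z i" if i: "i < n" for i
  proof (rule LIMSEQ_le)
    have "(\<lambda>m. 1 / real (Suc (r m))) \<longlonglongrightarrow> 0"
      using LIMSEQ_subseq_LIMSEQ[OF LIMSEQ_inverse_real_of_nat r] by (simp add: o_def field_simps)
    hence "(\<lambda>m. rho - 1 / real (Suc (r m))) \<longlonglongrightarrow> rho - 0" by (intro tendsto_intros)
    thus "(\<lambda>m. (rho - 1 / real (Suc (r m))) * Z (r m) i) \<longlonglongrightarrow> rho * z i"
      by (intro tendsto_mult lim i) auto
    show "(\<lambda>m. actT (Z (r m)) i) \<longlonglongrightarrow> actT z i"
      unfolding actT_def by (intro tendsto_intros lim) auto
    have "(rho - 1 / real (Suc (r m))) * Z (r m) i \<le> actT (Z (r m)) i" for m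
      using mult_right_mono[OF less_imp_le[OF s(2)] Z(1)[OF i]] Z(3)[OF i] by (rule order_trans)
    thus "\<exists>N. \<forall>m\<ge>N. (rho - 1 / real (Suc (r m))) * Z (r m) i \<le> actT (Z (r m)) i" by blast
  qed
  have eq: "actT z i = rho * z i" if "i < n" for i
  proof (rule ccontr)
    assume "actT z i \<noteq> rho * z i"
    hence strict: "actT z i - rho * z i > 0" using zrho[OF that] by simp
    define z' where "z' = actK z"
    have z'pos: "z' l > 0" if "l < n" for l
      unfolding z'_def by (rule actK_pos[of _ z j0]) (use that z0 j0 in auto)
    have d: "actT z' l - rho * z' l > 0" if l: "l < n" for l
    proof -
      have "actT z' l - rho * z' l = actK (\<lambda>j. actT z j - rho * z j) l"
        unfolding z'_def comm[OF l]
        by (simp add: actK_def algebra_simps sum_subtractf sum_distrib_left)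
      also have "\<dots> > 0" using l zrho \<open>i < n\<close> strict by (intro actK_pos[of _ _ i]) auto
      finally show ?thesis .
    qed
    define e where "e = Min ((\<lambda>l. (actT z' l - rho * z' l) / z' l) ` {..<n})"
    have e0: "e > 0" unfolding e_def using d z'pos that by (subst Min_gr_iff) auto
    have "rho + e \<in> R"
    proof (rule RI[of z' i])
      fix l assume l: "l < n"
      have "e \<le> (actT z' l - rho * z' l) / z' l" unfolding e_def using l by (intro Min_le) auto
      thus "(rho + e) * z' l \<le> actT z' l" using z'pos[OF l] by (simp add: field_simps)
    qed (use z'pos that in \<open>auto simp: less_imp_le\<close>)
    hence "rho + e \<le> rho" unfolding rho_def using bdd by (rule cSup_upper)
    thus False using e0 by simp
  qed
  have "eigenvalue T rho"
    unfolding eigenvalue_iff_entrywise[OF T] using eq j0 unfolding actT_def by (intro exI[of _ z]) force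
  hence rho: "rho = lam" using lam lam_rho unfolding largest_eigenvalue_def by force
  show ?thesis
  proof (rule that[of "actK z"])
    fix i assume i: "i < n"
    show "actK z i > 0" by (rule actK_pos[of _ z j0]) (use i z0 j0 in auto)
    have "actT (actK z) i = lam * actK z i"
      unfolding comm[OF i] using eq rho by (simp add: actK_def sum_distrib_left mult.left_commute)
    thus "(\<Sum>j<n. T $$ (i, j) * actK z j) = lam * actK z i" by (simp add: actT_def)
  qed (use j0 in auto)
qed

section \<open>Languages and the subshifts they define\<close>

definition window :: "(int \<Rightarrow> 'a) \<Rightarrow> int \<Rightarrow> nat \<Rightarrow> 'a list" where
  "window x i m = map (\<lambda>j. x (i + int j)) [0..<m]"

lemma length_window [simp]: "length (window x i m) = m"
  by (simp add: window_def)

lemma nth_window [simp]: "j < m \<Longrightarrow> window x i m ! j = x (i + int j)"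
  by (simp add: window_def)

lemma appears_in_iff_window: "appears_in w x \<longleftrightarrow> (\<exists>i. window x i (length w) = w)"
  unfolding appears_in_def by (auto simp: list_eq_iff_nth_eq)

lemma window_add: "window x i (m + m') = window x i m @ window x (i + int m) m'"
  by (rule nth_equalityI) (auto simp: nth_append)

lemma window_in_words: "x \<in> X \<Longrightarrow> window x i m \<in> words_of_length X m"
  unfolding words_of_length_def appears_in_iff_window by auto

lemma words_of_lengthE:
  assumes "w \<in> words_of_length X m"
  obtains x i where "x \<in> X" "w = window x i m"
proof -
  have w: "length w = m" "\<exists>x\<in>X. appears_in w x"
    using assms by (simp_all add: words_of_length_def)
  then obtain x i where "x \<in> X" "window x i (length w) = w"
    unfolding appears_in_iff_window by blast
  thus ?thesis using w(1) by (intro that[of x i]) simp_all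
qed

lemma finite_words_of_length:
  assumes "\<And>x i. x \<in> X \<Longrightarrow> x i < (n :: nat)"
  shows "finite (words_of_length X m)"
proof (rule finite_subset)
  show "words_of_length X m \<subseteq> {w. set w \<subseteq> {..<n} \<and> length w = m}"
    using assms by (auto elim!: words_of_lengthE simp: window_def)
qed (simp add: finite_lists_length_eq)

lemma card_words_submultiplicative:
  assumes fin: "\<And>m. finite (words_of_length X m)"
  shows "card (words_of_length X (m + m')) \<le> card (words_of_length X m) * card (words_of_length X m')"
proof -
  have "words_of_length X (m + m')
      \<subseteq> (\<lambda>(u, v). u @ v) ` (words_of_length X m \<times> words_of_length X m')"
  proof
    fix w assume "w \<in> words_of_length X (m + m')"
    then obtain x i where "x \<in> X" "w = window x i m @ window x (i + int m) m'"
      by (auto elim!: words_of_lengthE simp: window_add)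
    thus "w \<in> (\<lambda>(u, v). u @ v) ` (words_of_length X m \<times> words_of_length X m')"
      by (intro image_eqI[of _ _ "(window x i m, window x (i + int m) m')"])
         (auto intro: window_in_words)
  qed
  hence "card (words_of_length X (m + m')) \<le> card (words_of_length X m \<times> words_of_length X m')"
    using fin by (intro surj_card_le) auto
  thus ?thesis by (simp add: card_cartesian_product)
qed

lemma entropy_as_limit:
  assumes alphabet: "\<And>x i. x \<in> X \<Longrightarrow> x i < (n :: nat)"
    and lower: "\<And>m. m > 0 \<Longrightarrow> c * real m \<le> ln (real (card (words_of_length X m)))"
    and "X \<noteq> {}"
  obtains h where "entropy X = ereal h"
    "(\<lambda>m. ln (real (card (words_of_length X m))) / real m) \<longlonglongrightarrow> h"
proof -
  define b where "b m = card (words_of_length X m)" for m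
  have fin: "finite (words_of_length X m)" for m by (rule finite_words_of_length[of X n]) (rule alphabet)
  obtain x where "x \<in> X" using \<open>X \<noteq> {}\<close> by blast
  hence pos: "b m > 0" for m
    unfolding b_def using window_in_words[of x X 0 m] fin[of m] by (auto simp: card_gt_0_iff)
  have "ln (real (b (m + m'))) \<le> ln (real (b m)) + ln (real (b m'))" for m m'
  proof -
    have "real (b (m + m')) \<le> real (b m) * real (b m')"
      using of_nat_mono[OF card_words_submultiplicative[OF fin, of m m']] by (simp add: b_def)
    hence "ln (real (b (m + m'))) \<le> ln (real (b m) * real (b m'))"
      using pos[of "m + m'"] by (intro ln_mono) auto
    thus ?thesis using pos[of m] pos[of m'] by (simp add: ln_mult_pos)
  qed
  moreover have "c * real m \<le> ln (real (b m))" if "m > 0" for m using lower[OF that] by (simp add: b_def)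
  ultimately have "convergent (\<lambda>m. ln (real (b m)) / real m)"
    by (rule subadditive_convergent)
  then obtain h where h: "(\<lambda>m. ln (real (b m)) / real m) \<longlonglongrightarrow> h" by (auto simp: convergent_def)
  hence "(\<lambda>m. ereal (ln (real (b m)) / real m)) \<longlonglongrightarrow> ereal h" by simp
  moreover have "\<forall>\<^sub>F m in sequentially. ereal (ln (real (b m)) / real m)
      = log_count (words_of_length X m) / ereal (real m)"
    using eventually_gt_at_top[of 0]
  proof eventually_elim
    case (elim m)
    thus ?case using pos[of m] by (simp add: log_count_def b_def)
  qed
  ultimately have "(\<lambda>m. log_count (words_of_length X m) / ereal (real m)) \<longlonglongrightarrow> ereal h"
    by (rule Lim_transform_eventually)
  hence "entropy X = ereal h" unfolding entropy_def by (rule limI)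
  with h show ?thesis using that by (simp add: b_def)
qed

text \<open>A set of finite words closed under taking blocks of consecutive symbols, over a finite alphabet. It
  defines a shift space, namely the sequences all of whose blocks belong to it, but it may contain words that do
  not occur in that space.\<close>

locale factorial_language =
  fixes P :: "nat list \<Rightarrow> bool" and n :: nat
  assumes factor: "P (u @ w @ v) \<Longrightarrow> P w"
    and alphabet: "P w \<Longrightarrow> set w \<subseteq> {..<n}"
begin

definition shift_space :: "(int \<Rightarrow> nat) set" where
  "shift_space = {x. \<forall>i m. P (window x i m)}"

definition level :: "nat \<Rightarrow> nat list set" where
  "level m = {w. length w = m \<and> P w}"

definition has_context :: "nat \<Rightarrow> nat list \<Rightarrow> bool" where
  "has_context M w \<longleftrightarrow> (\<exists>u v. M \<le> length u \<and> M \<le> length v \<and> P (u @ w @ v))"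

lemma level_subset: "level m \<subseteq> {w. set w \<subseteq> {..<n} \<and> length w = m}"
  using alphabet by (auto simp: level_def)

lemma finite_level: "finite (level m)"
  by (rule finite_subset[OF level_subset]) (simp add: finite_lists_length_eq)

lemma card_level_le: "card (level m) \<le> n ^ m"
  using card_mono[OF _ level_subset[of m]] by (simp add: finite_lists_length_eq card_lists_length_eq)

lemma words_subset_level: "words_of_length shift_space m \<subseteq> level m"
  by (auto elim!: words_of_lengthE simp: shift_space_def level_def)

lemma has_context_mono: "has_context M' w \<Longrightarrow> M \<le> M' \<Longrightarrow> has_context M w"
  unfolding has_context_def using order_trans[of M M'] by blast

lemma has_context_P: "has_context M w \<Longrightarrow> P w"
proof -
  assume "has_context M w"
  then obtain u v where "P (u @ w @ v)" unfolding has_context_def by blast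
  thus "P w" by (rule factor)
qed

text \<open>Pigeonhole: each of the arbitrarily long contexts has some pair of symbols next to \<open>w\<close>, there are finitely many
  pairs, and shortening a context keeps it valid. So one pair serves contexts of every length.\<close>

lemma has_context_extend:
  assumes ctx: "\<And>M. has_context M w"
  shows "\<exists>a b. \<forall>M. has_context M (a # w @ [b])"
proof (rule ccontr)
  assume "\<not> ?thesis"
  hence "\<forall>a b. \<exists>M. \<not> has_context M (a # w @ [b])" by blast
  then obtain f where f: "\<And>a b. \<not> has_context (f a b) (a # w @ [b])" by metis
  define M where "M = Max ((\<lambda>(a, b). f a b) ` ({..<n} \<times> {..<n}))"
  obtain u v where uv: "Suc M \<le> length u" "Suc M \<le> length v" "P (u @ w @ v)"
    using ctx[of "Suc M"] unfolding has_context_def by blast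
  obtain u' a where u: "u = u' @ [a]" using uv(1) by (cases u rule: rev_cases) auto
  obtain b v' where v: "v = b # v'" using uv(2) by (cases v) auto
  have "a < n" "b < n" using alphabet[OF uv(3)] by (auto simp: u v)
  hence "f a b \<le> M" unfolding M_def by (intro Max_ge) (auto intro!: image_eqI[of _ _ "(a, b)"])
  moreover have "has_context M (a # w @ [b])"
    unfolding has_context_def using uv by (intro exI[of _ u'] exI[of _ v']) (auto simp: u v)
  ultimately show False using f has_context_mono by blast
qed

text \<open>Koenig's lemma: iterating \<open>has_context_extend\<close> gives words \<open>W N\<close> growing by one symbol on each side,
  which exhaust a bi-infinite sequence.\<close>

lemma arbitrary_contexts_imp_appears:
  assumes ctx: "\<And>M. has_context M w"
  shows "\<exists>x\<in>shift_space. appears_in w x"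
proof -
  have "\<exists>W. \<forall>N. ((\<forall>M. has_context M (W N)) \<and> (N = 0 \<longrightarrow> W N = w))
      \<and> (\<exists>a b. W (Suc N) = a # W N @ [b])"
  proof (rule dependent_nat_choice)
    show "\<exists>W0. (\<forall>M. has_context M W0) \<and> (0 = (0::nat) \<longrightarrow> W0 = w)" using ctx by blast
  next
    fix W0 N assume "(\<forall>M. has_context M W0) \<and> (N = (0::nat) \<longrightarrow> W0 = w)"
    then obtain a b where "\<forall>M. has_context M (a # W0 @ [b])"
      using has_context_extend by blast
    thus "\<exists>W1. ((\<forall>M. has_context M W1) \<and> (Suc N = 0 \<longrightarrow> W1 = w)) \<and> (\<exists>a b. W1 = a # W0 @ [b])"
      by blast
  qed
  then obtain W where W_all: "\<forall>N. ((\<forall>M. has_context M (W N)) \<and> (N = 0 \<longrightarrow> W N = w))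
      \<and> (\<exists>a b. W (Suc N) = a # W N @ [b])" by (rule exE)
  have W: "has_context M (W N)" "W 0 = w" "\<exists>a b. W (Suc N) = a # W N @ [b]" for N M
    using W_all by blast+
  have len: "length (W N) = length w + 2 * N" for N
  proof (induction N)
    case (Suc N)
    thus ?case using W(3)[of N] by fastforce
  qed (simp add: W)
  have shift: "W (N + d) ! (j + d) = W N ! j" if "j < length w + 2 * N" for N d j
  proof (induction d)
    case (Suc d)
    obtain a b where "W (Suc (N + d)) = a # W (N + d) @ [b]" using W(3) by blast
    moreover have "j + d < length (W (N + d))" using that by (simp add: len)
    ultimately show ?case using Suc by (simp add: nth_append)
  qed simp
  \<comment> \<open>The symbol at position \<open>i\<close> has index \<open>i + N\<close> in \<open>W N\<close>, and \<open>N = \<bar>i\<bar> + 1\<close> is large enough to reach it.\<close>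
  define x where "x i = W (nat \<bar>i\<bar> + 1) ! nat (i + int (nat \<bar>i\<bar> + 1))" for i
  have x: "x i = W N ! nat (i + int N)" if "- int N \<le> i" "i < int (length w + N)" for i N
  proof -
    let ?N = "nat \<bar>i\<bar> + 1"
    have "W (N + ?N) ! (nat (i + int N) + ?N) = W N ! nat (i + int N)"
      using that by (intro shift) auto
    moreover have "W (?N + N) ! (nat (i + int ?N) + N) = W ?N ! nat (i + int ?N)"
      by (intro shift) auto
    moreover have "nat (i + int N) + ?N = nat (i + int ?N) + N" "?N + N = N + ?N"
      using that by auto
    ultimately show ?thesis unfolding x_def by (simp only:)
  qed
  have "window x 0 (length w) = w"
    using x[of 0] W(2) by (intro nth_equalityI) auto
  moreover have "x \<in> shift_space"
  proof -
    have "P (window x i m)" for i m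
    proof -
      define N where "N = nat \<bar>i\<bar> + m + 1"
      define p where "p = nat (i + int N)"
      have pm: "p + m \<le> length (W N)" unfolding len p_def N_def by auto
      have "window x i m = take m (drop p (W N))"
      proof (rule nth_equalityI)
        fix j assume "j < length (window x i m)"
        hence j: "j < m" by simp
        have "x (i + int j) = W N ! nat (i + int j + int N)"
          using j by (intro x) (auto simp: N_def)
        also have "nat (i + int j + int N) = p + j" unfolding p_def N_def by auto
        finally show "window x i m ! j = take m (drop p (W N)) ! j" using j pm by simp
      qed (use pm in auto)
      moreover have "P (take p (W N) @ take m (drop p (W N)) @ drop m (drop p (W N)))"
        using has_context_P[OF W(1)] by (simp only: append_take_drop_id)
      ultimately show ?thesis using factor by simp
    qed
    thus ?thesis by (simp add: shift_space_def)
  qed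
  ultimately show ?thesis
    unfolding appears_in_iff_window by (intro bexI[of _ x] exI[of _ 0])
qed

text \<open>Uniformity by finiteness: each word of length \<open>m\<close> that does not occur in the shift space fails to have
  contexts of some length, and there are finitely many words in the language to consider.\<close>

lemma long_context_imp_word:
  "\<exists>M. \<forall>w. length w = m \<longrightarrow> has_context M w \<longrightarrow> w \<in> words_of_length shift_space m"
proof -
  have "\<forall>w. \<exists>M. length w = m \<longrightarrow> w \<notin> words_of_length shift_space m \<longrightarrow> \<not> has_context M w"
    using arbitrary_contexts_imp_appears unfolding words_of_length_def by blast
  then obtain f where f: "\<And>w. length w = m \<Longrightarrow> w \<notin> words_of_length shift_space m \<Longrightarrow> \<not> has_context (f w) w"
    by metis
  define M where "M = Max (insert 0 (f ` level m))"
  have "w \<in> words_of_length shift_space m" if "length w = m" "has_context M w" for w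
  proof (rule ccontr)
    assume "w \<notin> words_of_length shift_space m"
    moreover have "f w \<le> M"
      unfolding M_def using that has_context_P finite_level by (intro Max_ge) (auto simp: level_def)
    ultimately show False using f that has_context_mono by blast
  qed
  thus ?thesis by blast
qed

text \<open>A word of length \<open>q * m + 2 * M\<close> consists of two ends of length \<open>M\<close> and \<open>q\<close> blocks of length \<open>m\<close> between
  them. Each block has contexts of length at least \<open>M\<close> on both sides, so for large \<open>M\<close> it is a word of the shift
  space.\<close>

lemma card_level_le_words:
  "\<exists>M0. \<forall>M\<ge>M0. \<forall>q. card (level (q * m + 2 * M))
     \<le> n ^ M * card (words_of_length shift_space m) ^ q * n ^ M"
proof -
  define B where "B = words_of_length shift_space m"
  have finB: "finite B" unfolding B_def by (rule finite_subset[OF words_subset_level finite_level])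
  obtain M0 where M0: "\<And>w. length w = m \<Longrightarrow> has_context M0 w \<Longrightarrow> w \<in> B"
    using long_context_imp_word unfolding B_def by blast
  have "card (level (q * m + 2 * M)) \<le> n ^ M * card B ^ q * n ^ M" if M: "M \<ge> M0" for M q
  proof -
    define F where "F q = {w. length w = q * m \<and> has_context M w}" for q
    have finF: "finite (F q)" for q
      by (rule finite_subset[OF _ finite_level[of "q * m"]])
         (auto simp: F_def level_def dest: has_context_P)
    have cardF: "card (F q) \<le> card B ^ q" for q
    proof (induction q)
      case 0
      have "F 0 \<subseteq> {[]}" by (auto simp: F_def)
      thus ?case using card_mono[of "{[]}" "F 0"] by simp
    next
      case (Suc q)
      have "F (Suc q) \<subseteq> (\<lambda>(u, v). u @ v) ` (B \<times> F q)"
      proof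
        fix w assume "w \<in> F (Suc q)"
        then obtain u v where w: "length w = m + q * m"
          and uv: "M \<le> length u" "M \<le> length v" "P (u @ w @ v)"
          by (auto simp: F_def has_context_def)
        have "has_context M (take m w)" unfolding has_context_def
          using uv by (intro exI[of _ u] exI[of _ "drop m w @ v"]) (simp flip: append_assoc[of "take m w"])
        moreover have "has_context M (drop m w)" unfolding has_context_def
          using uv by (intro exI[of _ "u @ take m w"] exI[of _ v])
            (simp flip: append_assoc[of "take m w"])
        ultimately have "take m w \<in> B" "drop m w \<in> F q"
          using w M0 has_context_mono[OF _ M] by (auto simp: F_def)
        thus "w \<in> (\<lambda>(u, v). u @ v) ` (B \<times> F q)"
          by (intro image_eqI[of _ _ "(take m w, drop m w)"]) auto
      qed
      hence "card (F (Suc q)) \<le> card (B \<times> F q)"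
        using finB finF by (intro surj_card_le) auto
      also have "\<dots> \<le> card B * card B ^ q" using Suc by (simp add: card_cartesian_product)
      finally show ?case by simp
    qed
    have "level (q * m + 2 * M) \<subseteq> (\<lambda>(u, w, v). u @ w @ v) ` (level M \<times> F q \<times> level M)"
    proof
      fix w assume "w \<in> level (q * m + 2 * M)"
      hence w: "length w = M + q * m + M" "P w" by (auto simp: level_def)
      define u a v where "u = take M w" and "a = take (q * m) (drop M w)"
        and "v = drop (q * m) (drop M w)"
      have eq: "w = u @ a @ v" unfolding u_def a_def v_def by (simp only: append_take_drop_id)
      have l: "length u = M" "length a = q * m" "length v = M"
        using w(1) unfolding u_def a_def v_def by auto
      have P: "P (u @ a @ v)" using w(2) eq by simp
      have "P u" using factor[of "[]" u "a @ v"] P by simp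
      moreover have "P v" using factor[of "u @ a" v "[]"] P by simp
      moreover have "has_context M a" unfolding has_context_def using P l by (intro exI[of _ u] exI[of _ v]) simp
      ultimately have "(u, a, v) \<in> level M \<times> F q \<times> level M" using l by (auto simp: level_def F_def)
      thus "w \<in> (\<lambda>(u, w, v). u @ w @ v) ` (level M \<times> F q \<times> level M)"
        using eq by (intro image_eqI[of _ _ "(u, a, v)"]) auto
    qed
    hence "card (level (q * m + 2 * M)) \<le> card (level M \<times> F q \<times> level M)"
      using finite_level finF by (intro surj_card_le) auto
    also have "\<dots> = card (level M) * card (F q) * card (level M)"
      by (simp add: card_cartesian_product mult_ac)
    also have "\<dots> \<le> n ^ M * card B ^ q * n ^ M"
      using card_level_le cardF by (intro mult_le_mono) auto
    finally show ?thesis .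
  qed
  thus ?thesis unfolding B_def by blast
qed

text \<open>The growth rate of the language along multiples of \<open>k\<close> passes to the shift space without loss, because
  the ends in \<open>card_level_le_words\<close> contribute only a constant factor as \<open>q\<close> tends to infinity.
  The end length is taken to be a multiple of \<open>k\<close> so that the words to be counted have length divisible by \<open>k\<close>.\<close>

lemma words_growth:
  fixes G c :: real
  assumes "c > 0" "G > 0" "k > 0"
    and growth: "\<And>N. c * G ^ N \<le> real (card (level (N * k)))"
  shows "G ^ m \<le> real (card (words_of_length shift_space m)) ^ k"
proof -
  define b where "b = card (words_of_length shift_space m)"
  obtain M0 where M0: "\<And>M q. M \<ge> M0 \<Longrightarrow> card (level (q * m + 2 * M)) \<le> n ^ M * b ^ q * n ^ M"
    using card_level_le_words[of m] unfolding b_def by blast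
  define M where "M = M0 * k"
  have M: "M \<ge> M0" using \<open>k > 0\<close> by (simp add: M_def)
  have bound: "(c * G ^ (2 * M0)) * (G ^ m) ^ q \<le> (real (n ^ M) * real (n ^ M)) * (real b ^ k) ^ q" for q
  proof -
    have "c * G ^ (q * m + 2 * M0) \<le> real (card (level ((q * m + 2 * M0) * k)))" by (rule growth)
    also have "(q * m + 2 * M0) * k = (k * q) * m + 2 * M" by (simp add: M_def algebra_simps)
    also have "real (card (level ((k * q) * m + 2 * M))) \<le> real (n ^ M * b ^ (k * q) * n ^ M)"
      using M0[OF M] by (rule of_nat_mono)
    finally show ?thesis by (simp add: power_add power_mult mult_ac)
  qed
  have "G ^ m \<le> real b ^ k"
    by (rule base_le_of_power_bound[OF _ _ _ bound]) (simp_all add: \<open>c > 0\<close> \<open>G > 0\<close>)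
  thus ?thesis by (simp add: b_def)
qed

end

section \<open>Admissible words avoiding a set of words\<close>

definition good_word :: "nat \<Rightarrow> real mat \<Rightarrow> nat list set \<Rightarrow> nat list \<Rightarrow> bool" where
  "good_word n T S w \<longleftrightarrow> admissible n T w \<and> (\<forall>\<tau>\<in>S. \<not> sublist \<tau> w)"

lemma admissible_Cons:
  "admissible n T (a # w) \<longleftrightarrow>
    a < n \<and> admissible n T w \<and> (w \<noteq> [] \<longrightarrow> T $$ (hd w, a) = 1)"
  unfolding admissible_def by (cases w) (auto simp: All_less_Suc2 nth_Cons' split: nat.splits)

lemma admissible_Nil: "admissible n T []"
  by (simp add: admissible_def)

lemma admissible_append: "admissible n T (u @ v) \<Longrightarrow> admissible n T u \<and> admissible n T v"
  by (induction u) (auto simp: admissible_Cons admissible_Nil)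

lemma admissible_set: "admissible n T w \<Longrightarrow> set w \<subseteq> {..<n}"
  by (auto simp: admissible_def in_set_conv_nth)

lemma factorial_good_word: "factorial_language (good_word n T S) n"
proof
  fix u w v assume uwv: "good_word n T S (u @ w @ v)"
  have "sublist w (u @ w @ v)" by (auto simp: sublist_def)
  hence "sublist \<tau> (u @ w @ v)" if "sublist \<tau> w" for \<tau>
    using that sublist_order.order_trans by blast
  thus "good_word n T S w"
    using uwv unfolding good_word_def by (blast dest: admissible_append)
qed (auto simp: good_word_def dest: admissible_set)

lemma admissible_window:
  assumes "x \<in> SFT n T" shows "admissible n T (window x i m)"
  using assms by (auto simp: admissible_def SFT_def add.commute add.left_commute)

lemma sublist_window_appears:
  assumes "sublist \<tau> (window x i m)" shows "appears_in \<tau> x"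
proof -
  obtain u v where "window x i m = u @ \<tau> @ v" using assms by (auto simp: sublist_def)
  moreover have "m = length u + (length \<tau> + length v)"
    using arg_cong[OF calculation, of length] by simp
  ultimately show ?thesis
    unfolding appears_in_iff_window by (auto simp: window_add)
qed

lemma shift_space_good_word:
  "factorial_language.shift_space (good_word n T S) = avoiding (SFT n T) S"
proof -
  interpret factorial_language "good_word n T S" n by (rule factorial_good_word)
  show ?thesis
  proof (intro equalityI subsetI)
    fix x assume "x \<in> shift_space"
    hence win: "good_word n T S (window x i m)" for i m by (simp add: shift_space_def)
    have "x i < n" "T $$ (x (i + 1), x i) = 1" for i
      using win[of i 2] by (auto simp: good_word_def window_def upt_rec admissible_Cons)
    moreover have "\<not> appears_in \<tau> x" if "\<tau> \<in> S" for \<tau>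
      using win that unfolding appears_in_iff_window good_word_def
      by (metis sublist_order.order_refl)
    ultimately show "x \<in> avoiding (SFT n T) S" by (auto simp: avoiding_def SFT_def)
  next
    fix x assume "x \<in> avoiding (SFT n T) S"
    thus "x \<in> shift_space"
      unfolding shift_space_def good_word_def avoiding_def
      using admissible_window sublist_window_appears by blast
  qed
qed

section \<open>Weighted counts of words and the two entropy bounds\<close>

locale weighted_sft =
  fixes n :: nat and T :: "real mat" and lam :: real and v :: "nat \<Rightarrow> real"
  assumes entries: "\<And>i j. i < n \<Longrightarrow> j < n \<Longrightarrow> T $$ (i, j) \<in> {0, 1}"
    and v_pos: "\<And>i. i < n \<Longrightarrow> v i > 0"
    and eigen: "\<And>i. i < n \<Longrightarrow> (\<Sum>j<n. T $$ (i, j) * v j) = lam * v i"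
    and n: "n > 0" and lam: "lam > 0"
begin

text \<open>The value at the empty word is the one for which \<open>left_extensions_weight\<close> also holds there, so that
  the recursion for the total weight starts at length 0.\<close>

definition weight :: "nat list \<Rightarrow> real" where
  "weight w = (if w = [] then (\<Sum>j<n. v j) / lam else v (hd w))"

definition weight_min :: real where
  "weight_min = Min (insert (weight []) (v ` {..<n}))"

definition weight_max :: real where
  "weight_max = Max (v ` {..<n})"

definition total_weight :: "nat list set \<Rightarrow> nat \<Rightarrow> real" where
  "total_weight S m = sum weight (factorial_language.level (good_word n T S) m)"

lemma weight_Nil_pos: "weight [] > 0"
  using n v_pos lam by (auto simp: weight_def intro!: sum_pos divide_pos_pos)

lemma weight_min_pos: "weight_min > 0"
  unfolding weight_min_def using weight_Nil_pos v_pos by (subst Min_gr_iff) auto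

lemma weight_max_pos: "weight_max > 0"
proof -
  have "v 0 \<le> weight_max" unfolding weight_max_def using n by (intro Max_ge) auto
  thus ?thesis using v_pos[OF n] by linarith
qed

lemma weight_ge_min: "set w \<subseteq> {..<n} \<Longrightarrow> weight_min \<le> weight w"
  unfolding weight_min_def by (rule Min_le) (auto simp: weight_def subset_iff)

lemma weight_le_max: "w \<noteq> [] \<Longrightarrow> set w \<subseteq> {..<n} \<Longrightarrow> weight w \<le> weight_max"
  unfolding weight_max_def by (rule Max_ge) (auto simp: weight_def subset_iff)

lemma left_extensions_weight:
  assumes w: "admissible n T w"
  shows "(\<Sum>a | a < n \<and> admissible n T (a # w). v a) = lam * weight w"
proof (cases w)
  case Nil
  thus ?thesis using lam by (simp add: admissible_Cons admissible_Nil weight_def lessThan_def)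
next
  case (Cons b w')
  have b: "b < n" using w by (simp add: Cons admissible_Cons)
  have "(\<Sum>a | a < n \<and> admissible n T (a # w). v a) = (\<Sum>a\<in>{a\<in>{..<n}. T $$ (b, a) = 1}. v a)"
    using w by (intro sum.cong) (auto simp: Cons admissible_Cons)
  also have "\<dots> = (\<Sum>a<n. if T $$ (b, a) = 1 then v a else 0)"
    by (rule sum.inter_filter) simp
  also have "\<dots> = (\<Sum>a<n. T $$ (b, a) * v a)"
    using entries[OF b] by (intro sum.cong) auto
  also have "\<dots> = lam * v b" by (rule eigen[OF b])
  finally show ?thesis by (simp add: Cons weight_def)
qed

context
  fixes S :: "nat list set"
begin

interpretation factorial_language "good_word n T S" n
  by (rule factorial_good_word)

definition extensions :: "nat \<Rightarrow> nat list set" where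
  "extensions m = (\<lambda>(w, a). a # w) ` Sigma (level m) (\<lambda>w. {a. a < n \<and> admissible n T (a # w)})"

lemma finite_extensions: "finite (extensions m)"
  unfolding extensions_def using finite_level by (intro finite_imageI finite_SigmaI) auto

lemma extensionsD: "w \<in> extensions m \<Longrightarrow> length w = Suc m \<and> admissible n T w"
  by (auto simp: extensions_def level_def)

lemma weight_nonneg: "set w \<subseteq> {..<n} \<Longrightarrow> weight w \<ge> 0"
  using weight_ge_min weight_min_pos by fastforce

lemma sum_weight_extensions: "sum weight (extensions m) = lam * total_weight S m"
proof -
  have "sum weight (extensions m)
      = (\<Sum>(w, a)\<in>Sigma (level m) (\<lambda>w. {a. a < n \<and> admissible n T (a # w)}). v a)"
    unfolding extensions_def
    by (subst sum.reindex) (auto simp: inj_on_def weight_def intro!: sum.cong)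
  also have "\<dots> = (\<Sum>w\<in>level m. \<Sum>a | a < n \<and> admissible n T (a # w). v a)"
    using finite_level by (subst sum.Sigma) auto
  also have "\<dots> = (\<Sum>w\<in>level m. lam * weight w)"
    by (intro sum.cong refl left_extensions_weight) (simp add: level_def good_word_def)
  finally show ?thesis by (simp add: total_weight_def sum_distrib_left)
qed

lemma level_Suc_subset: "level (Suc m) \<subseteq> extensions m"
proof
  fix w assume w: "w \<in> level (Suc m)"
  then obtain a w' where aw: "w = a # w'" "length w' = m" by (auto simp: level_def length_Suc_conv)
  have "good_word n T S w'" using factor[of "[a]" w' "[]"] w by (simp add: level_def aw)
  thus "w \<in> extensions m"
    using w unfolding extensions_def
    by (intro image_eqI[of _ _ "(w', a)"]) (auto simp: level_def aw good_word_def admissible_Cons)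
qed

lemma level_alphabet: "w \<in> level m \<Longrightarrow> set w \<subseteq> {..<n}"
  using level_subset by auto

lemma total_growth: "total_weight S (Suc m) \<le> lam * total_weight S m"
proof -
  have "sum weight (level (Suc m)) \<le> sum weight (extensions m)"
    by (intro sum_mono2 finite_extensions level_Suc_subset weight_nonneg)
       (auto dest!: extensionsD admissible_set)
  thus ?thesis by (simp add: sum_weight_extensions) (simp add: total_weight_def)
qed

lemma card_level_le_total: "weight_min * real (card (level m)) \<le> total_weight S m"
proof -
  have "(\<Sum>w\<in>level m. weight_min) \<le> total_weight S m"
    unfolding total_weight_def by (intro sum_mono weight_ge_min level_alphabet)
  thus ?thesis by (simp add: mult.commute)
qed

lemma total_nonneg: "total_weight S m \<ge> 0"
  unfolding total_weight_def by (intro sum_nonneg weight_nonneg level_alphabet)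

text \<open>The word without its new first symbol avoids \<open>S\<close>, so a forbidden word in the extension can only sit at the very
  beginning.\<close>

lemma forbidden_extensions:
  assumes "w \<in> extensions m" "w \<notin> level (Suc m)"
  obtains \<tau> u where "\<tau> \<in> S" "w = \<tau> @ u" "length \<tau> \<le> Suc m" "u \<in> level (Suc m - length \<tau>)"
proof -
  obtain a w' where w: "w = a # w'" "w' \<in> level m" "admissible n T w"
    using assms(1) by (auto simp: extensions_def)
  then obtain \<tau> where \<tau>: "\<tau> \<in> S" "sublist \<tau> w"
    using assms(2) by (auto simp: level_def good_word_def)
  have "\<not> sublist \<tau> w'" using w(2) \<tau>(1) by (auto simp: level_def good_word_def)
  hence "prefix \<tau> w" using \<tau>(2) by (auto simp: w(1) sublist_Cons_right)
  then obtain u where u: "w = \<tau> @ u" by (auto simp: prefix_def)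
  have "length w = Suc m" using w by (simp add: level_def)
  moreover have "good_word n T S u"
  proof (cases \<tau>)
    case Nil
    thus ?thesis using \<open>\<not> sublist \<tau> w'\<close> by simp
  next
    case (Cons c \<tau>')
    hence "w' = \<tau>' @ u" using u w(1) by simp
    thus ?thesis using factor[of \<tau>' u "[]"] w(2) by (simp add: level_def)
  qed
  ultimately show ?thesis using that[OF \<tau>(1) u] u by (simp add: level_def)
qed

text \<open>The discarded extensions weigh at most \<open>weight_max\<close> each, and by \<open>forbidden_extensions\<close> there are
  at most as many of them as pairs of a forbidden word and a shorter avoiding word. Each of the latter weighs at least
  \<open>weight_min\<close>, which brings their number back to a total weight.\<close>

lemma total_loss:
  assumes S: "finite S" "\<And>\<tau>. \<tau> \<in> S \<Longrightarrow> \<tau> \<noteq> []"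
  shows "total_weight S (Suc m) \<ge> lam * total_weight S m - weight_max / weight_min *
    (\<Sum>\<tau>\<in>S. if length \<tau> \<le> Suc m then total_weight S (Suc m - length \<tau>) else 0)"
proof -
  define D where "D \<tau> = (if length \<tau> \<le> Suc m then level (Suc m - length \<tau>) else {})" for \<tau> :: "nat list"
  have finD: "finite (D \<tau>)" for \<tau> using finite_level by (simp add: D_def)
  have sub: "extensions m - level (Suc m) \<subseteq> (\<lambda>(\<tau>, u). \<tau> @ u) ` Sigma S D"
  proof
    fix w assume "w \<in> extensions m - level (Suc m)"
    then obtain \<tau> u where "\<tau> \<in> S" "w = \<tau> @ u" "length \<tau> \<le> Suc m" "u \<in> level (Suc m - length \<tau>)"
      using forbidden_extensions by blast
    thus "w \<in> (\<lambda>(\<tau>, u). \<tau> @ u) ` Sigma S D"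
      by (intro image_eqI[of _ _ "(\<tau>, u)"]) (auto simp: D_def)
  qed
  have "card (extensions m - level (Suc m)) \<le> card (Sigma S D)"
    using S finD sub by (intro surj_card_le) auto
  also have "\<dots> = (\<Sum>\<tau>\<in>S. card (D \<tau>))" using S finD by (simp add: card_SigmaI)
  finally have card: "real (card (extensions m - level (Suc m))) \<le> (\<Sum>\<tau>\<in>S. real (card (D \<tau>)))"
    by (simp flip: of_nat_sum)
  have "lam * total_weight S m - total_weight S (Suc m) = sum weight (extensions m - level (Suc m))"
    using finite_extensions level_Suc_subset
    by (simp add: sum_diff sum_weight_extensions) (simp add: total_weight_def)
  also have "\<dots> \<le> (\<Sum>w\<in>extensions m - level (Suc m). weight_max)"
    by (intro sum_mono weight_le_max) (auto dest!: extensionsD admissible_set)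
  also have "\<dots> \<le> weight_max * (\<Sum>\<tau>\<in>S. real (card (D \<tau>)))"
    using mult_left_mono[OF card] weight_max_pos by (simp add: mult.commute)
  also have "(\<Sum>\<tau>\<in>S. real (card (D \<tau>)))
      \<le> (\<Sum>\<tau>\<in>S. (if length \<tau> \<le> Suc m then total_weight S (Suc m - length \<tau>) else 0) / weight_min)"
  proof (intro sum_mono)
    fix \<tau> assume "\<tau> \<in> S"
    show "real (card (D \<tau>)) \<le> (if length \<tau> \<le> Suc m then total_weight S (Suc m - length \<tau>) else 0) / weight_min"
      using card_level_le_total[of "Suc m - length \<tau>"] weight_min_pos
      by (simp add: D_def field_simps)
  qed
  also have "weight_max * \<dots> = weight_max / weight_min *
      (\<Sum>\<tau>\<in>S. if length \<tau> \<le> Suc m then total_weight S (Suc m - length \<tau>) else 0)"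
    by (simp add: sum_divide_distrib[symmetric])
  finally show ?thesis using weight_max_pos by simp
qed

lemma total_upper: "total_weight S m \<le> lam ^ m * total_weight S 0"
proof (induction m)
  case (Suc m)
  have "total_weight S (Suc m) \<le> lam * total_weight S m" by (rule total_growth)
  also have "\<dots> \<le> lam * (lam ^ m * total_weight S 0)" using Suc lam by (intro mult_left_mono) auto
  finally show ?case by simp
qed simp

lemma total_0:
  assumes "\<And>\<tau>. \<tau> \<in> S \<Longrightarrow> \<tau> \<noteq> []"
  shows "total_weight S 0 = weight []"
proof -
  have "level 0 = {[]}"
    using assms by (auto simp: level_def good_word_def admissible_Nil)
  thus ?thesis by (simp add: total_weight_def)
qed

lemma total_le_card: 
  assumes "m > 0"
  shows "total_weight S m \<le> weight_max * real (card (level m))"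
proof -
  have "total_weight S m \<le> (\<Sum>w\<in>level m. weight_max)"
    unfolding total_weight_def using assms
    by (intro sum_mono weight_le_max level_alphabet) (auto simp: level_def)
  thus ?thesis by (simp add: mult.commute)
qed

text \<open>Weights are bounded, so the growth of the total weight is that of the number of avoiding words,
  which \<open>words_growth\<close> transfers to the words of the subshift. In particular there are such words of every
  length, so that the subshift is nonempty and its entropy finite.\<close>

lemma entropy_lower_bound:
  assumes S: "finite S" "\<And>\<tau>. \<tau> \<in> S \<Longrightarrow> \<tau> \<noteq> []" and G: "G > 0" and k: "k > 0"
    and growth: "\<And>N. total_weight S (N * k) \<ge> G ^ N * total_weight S 0"
  obtains h where "entropy (avoiding (SFT n T) S) = ereal h" "h \<ge> ln G / real k"
    "avoiding (SFT n T) S \<noteq> {}"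
proof -
  let ?X = "avoiding (SFT n T) S"
  define b where "b m = card (words_of_length ?X m)" for m
  \<comment> \<open>The minimum with 1 covers length 0, since the empty word may weigh more than \<open>weight_max\<close>.\<close>
  define c where "c = min 1 (weight [] / weight_max)"
  have c: "c > 0" using weight_Nil_pos weight_max_pos by (simp add: c_def)
  have level0: "card (level 0) = 1"
  proof -
    have "level 0 = {[]}"
      using S by (auto simp: level_def good_word_def admissible_Nil)
    thus ?thesis by simp
  qed
  have "c * G ^ N \<le> real (card (level (N * k)))" for N
  proof (cases "N = 0")
    case True
    thus ?thesis using level0 by (simp add: c_def)
  next
    case False
    have "weight [] * G ^ N \<le> weight_max * real (card (level (N * k)))"
      using growth[of N] total_le_card[of "N * k"] False k total_0[OF S(2)] by (simp add: mult.commute)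
    hence "weight [] / weight_max * G ^ N \<le> real (card (level (N * k)))"
      using weight_max_pos by (simp add: field_simps)
    moreover have "c * G ^ N \<le> weight [] / weight_max * G ^ N"
      using G by (intro mult_right_mono) (auto simp: c_def)
    ultimately show ?thesis by linarith
  qed
  hence pow: "G ^ m \<le> real (b m) ^ k" for m
    unfolding b_def shift_space_good_word[symmetric] by (rule words_growth[OF c G k])
  have pos: "b m > 0" for m
  proof (rule ccontr)
    assume "\<not> b m > 0"
    hence "G ^ m \<le> 0" using pow[of m] k by (simp add: power_0_left)
    thus False using G by (metis not_less zero_less_power)
  qed
  have lower: "ln G / real k * real m \<le> ln (real (b m))" for m
  proof -
    have "ln (G ^ m) \<le> ln (real (b m) ^ k)" using pow[of m] G by (intro ln_mono) auto
    hence "real m * ln G \<le> real k * ln (real (b m))" using G pos[of m] by (simp add: ln_realpow)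
    thus ?thesis using k by (simp add: field_simps)
  qed
  have nonempty: "?X \<noteq> {}"
  proof
    assume "?X = {}"
    hence "b 0 = 0" by (simp add: b_def words_of_length_def)
    thus False using pos[of 0] by simp
  qed
  obtain h where h: "entropy ?X = ereal h" "(\<lambda>m. ln (real (b m)) / real m) \<longlonglongrightarrow> h"
    using entropy_as_limit[of ?X n "ln G / real k"] lower nonempty
    unfolding b_def by (auto simp: avoiding_def SFT_def)
  have "ln G / real k \<le> h"
  proof (rule LIMSEQ_le_const[OF h(2)], intro exI allI impI)
    fix m :: nat assume "1 \<le> m"
    thus "ln G / real k \<le> ln (real (b m)) / real m"
      using lower[of m] by (simp add: field_simps)
  qed
  thus ?thesis using that h(1) nonempty by blast
qed

end

text \<open>Every word of the subshift is admissible, and the admissible words of length \<open>m\<close>, having weight at least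
  \<open>weight_min\<close>, number at most a constant times \<open>lam ^ m\<close>.\<close>

lemma SFT_entropy_upper_bound:
  assumes "SFT n T \<noteq> {}"
  obtains h where "entropy (SFT n T) = ereal h" "h \<le> ln lam"
proof -
  interpret factorial_language "good_word n T {}" n by (rule factorial_good_word)
  have eq: "shift_space = SFT n T" by (simp add: shift_space_good_word avoiding_def)
  define b where "b m = card (words_of_length (SFT n T) m)" for m
  obtain x where x: "x \<in> SFT n T" using assms by blast
  have fin: "finite (words_of_length (SFT n T) m)" for m
    by (rule finite_words_of_length[of _ n]) (simp add: SFT_def)
  have pos: "b m \<ge> 1" for m
    unfolding b_def using window_in_words[OF x, of 0 m] fin[of m]
    by (metis One_nat_def Suc_leI card_gt_0_iff empty_iff)
  define K where "K = weight [] / weight_min"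
  have K: "K > 0" unfolding K_def using weight_Nil_pos weight_min_pos by simp
  have bK: "real (b m) \<le> K * lam ^ m" for m
  proof -
    have "b m \<le> card (level m)"
      unfolding b_def using words_subset_level finite_level by (simp add: eq card_mono)
    hence "weight_min * real (b m) \<le> weight_min * real (card (level m))"
      using weight_min_pos by simp
    also have "\<dots> \<le> lam ^ m * weight []"
      using card_level_le_total[of "{}" m] total_upper[of "{}" m] total_0[of "{}"] by simp
    finally show ?thesis using weight_min_pos by (simp add: K_def field_simps)
  qed
  obtain h where h: "entropy (SFT n T) = ereal h" "(\<lambda>m. ln (real (b m)) / real m) \<longlonglongrightarrow> h"
    using entropy_as_limit[of "SFT n T" n 0] pos assms
    unfolding b_def by (auto simp: SFT_def)
  have "(\<lambda>m. ln K / real m + ln lam) \<longlonglongrightarrow> 0 + ln lam"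
    by (intro tendsto_add lim_const_over_n tendsto_const)
  moreover have "ln (real (b m)) / real m \<le> ln K / real m + ln lam" if "m \<ge> 1" for m
  proof -
    have "ln (real (b m)) \<le> ln (K * lam ^ m)" using bK[of m] pos[of m] by (intro ln_mono) auto
    also have "\<dots> = ln K + real m * ln lam" using K lam by (simp add: ln_mult_pos ln_realpow)
    finally show ?thesis using that by (simp add: field_simps)
  qed
  ultimately have "h \<le> 0 + ln lam" using h(2) by (intro LIMSEQ_le[of _ h]) auto
  thus ?thesis using that h(1) by simp
qed

end

section \<open>The entropy estimate\<close>

theorem theorem1:
  fixes n :: nat and T :: "real mat" and lam :: real
  assumes "zero_one_mat n T"
    and "irreducible_mat n T"
    and "largest_eigenvalue T lam"
    and "lam > 1"
  shows "\<exists>C::real. \<forall>(S :: nat list set) (k :: nat) (t :: real) (r :: real).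
     finite S \<longrightarrow>
     (\<forall>\<tau>\<in>S. admissible n T \<tau> \<and> \<tau> \<noteq> []) \<longrightarrow>
     (\<forall>\<sigma>\<in>S. \<forall>\<tau>\<in>S. sublist \<sigma> \<tau> \<longrightarrow> \<sigma> = \<tau>) \<longrightarrow>
     k > 0 \<longrightarrow>
     (\<forall>\<tau>\<in>S. length \<tau> \<ge> k) \<longrightarrow>
     1 < t \<longrightarrow> t < lam ^ k \<longrightarrow>
     r = (1 + real k * C * lam ^ (2 * k) * length_poly S (t powr (1 / real k) / lam)) / t \<longrightarrow>
     r < 1 \<longrightarrow>
     entropy (SFT n T) - entropy (avoiding (SFT n T) S) \<le> ereal (- ln (1 - r) / real k)"
proof -
  have T: "T \<in> carrier_mat n n" and entries: "\<And>i j. i < n \<Longrightarrow> j < n \<Longrightarrow> T $$ (i, j) \<in> {0, 1}"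
    using assms(1) by (auto simp: zero_one_mat_def)
  have nonneg: "\<And>i j. i < n \<Longrightarrow> j < n \<Longrightarrow> T $$ (i, j) \<ge> 0" using entries by force
  obtain v where v: "\<And>i. i < n \<Longrightarrow> v i > 0"
    "\<And>i. i < n \<Longrightarrow> (\<Sum>j<n. T $$ (i, j) * v j) = lam * v i" and n: "n > 0"
    by (rule perron_eigenvector[OF T nonneg assms(2,3)]) (use assms(4) in auto)
  interpret weighted_sft n T lam v
    using entries v n assms(4) by unfold_locales auto
  define C where "C = weight_max / weight_min"
  have C: "C \<ge> 0" using weight_max_pos weight_min_pos by (simp add: C_def)
  show ?thesis
  proof (intro exI[of _ C] allI impI)
    fix S :: "nat list set" and k :: nat and t r :: real
    assume S: "finite S" "\<forall>\<tau>\<in>S. admissible n T \<tau> \<and> \<tau> \<noteq> []" and k: "k > 0"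
      and len: "\<forall>\<tau>\<in>S. length \<tau> \<ge> k" and t: "1 < t" "t < lam ^ k"
      and r: "r = (1 + real k * C * lam ^ (2 * k) * length_poly S (t powr (1 / real k) / lam)) / t"
        "r < 1"
    define s where "s = t powr (1 / real k)"
    have sk: "s ^ k = t" using t k by (simp add: s_def powr_realpow[symmetric] powr_powr)
    have s1: "s > 1" using t k unfolding s_def by (simp add: gr_one_powr)
    have ne: "\<And>\<tau>. \<tau> \<in> S \<Longrightarrow> \<tau> \<noteq> []" using S by blast
    interpret forbidden_recursion "total_weight S" S length lam C s k
    proof
      have "r * t < 1 * t" using r(2) t by (intro mult_strict_right_mono) auto
      moreover have "r * t = 1 + real k * C * lam ^ (2 * k) * (\<Sum>\<tau>\<in>S. (s / lam) ^ length \<tau>)"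
        unfolding r(1) using t by (simp add: length_poly_def s_def)
      ultimately show "1 + real k * C * lam ^ (2 * k) * (\<Sum>\<tau>\<in>S. (s / lam) ^ length \<tau>) < s ^ k"
        unfolding sk by simp
    qed (use total_nonneg total_growth total_loss[OF S(1) ne] k len C s1 sk t lam in \<open>auto simp: C_def\<close>)
    have r_eq: "r = loss_ratio"
      unfolding r(1) loss_ratio_def sk by (simp add: length_poly_def s_def)
    have G: "lam ^ k * (1 - r) > 0" using r lam by simp
    obtain h where h: "entropy (avoiding (SFT n T) S) = ereal h"
      "h \<ge> ln (lam ^ k * (1 - r)) / real k" and ne': "avoiding (SFT n T) S \<noteq> {}"
      using entropy_lower_bound[OF S(1) ne G k block_growth[folded r_eq]] by blast
    have "ln (lam ^ k * (1 - r)) = real k * ln lam + ln (1 - r)"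
      using lam r by (simp add: ln_mult_pos ln_realpow)
    hence hk: "h \<ge> ln lam + ln (1 - r) / real k" using h(2) k by (simp add: add_divide_distrib)
    have "SFT n T \<noteq> {}" using ne' by (auto simp: avoiding_def)
    then obtain h' where h': "entropy (SFT n T) = ereal h'" "h' \<le> ln lam"
      by (rule SFT_entropy_upper_bound)
    show "entropy (SFT n T) - entropy (avoiding (SFT n T) S) \<le> ereal (- ln (1 - r) / real k)"
      unfolding h(1) h'(1) using hk h'(2) by simp
  qed
qed

end
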